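(* Let $\epsilon>0$, $\tau>0$ with $\epsilon+\tau\le 1$, let $N\ge 1$ be an integer, and let $s:(0,1]\to(0,\infty)$ be a twice differentiable positive function with $s'(t)>0$ and $s''(t)\ge 0$ for all $t\in(0,1]$. Put $s_0=s(\epsilon)$, $s_{1/2}=s(\epsilon+\tau/2)$, $s_1=s(\epsilon+\tau)$, and assume $2s_{1/2}>s_1$. Let $v(x)=\frac{s(|x|)}{|x|}x$. Then the Jacobian determinant $\det\frac{\partial \Pi v(F_T(\hat x))}{\partial \hat x}$ of the quadratic iso-parametric interpolation of $v$ is positive (for all $\hat x\in\hat T$) on all the curved elements $T$ of types A and B in $\Omega_{(\epsilon,\tau)}$ if and only if $$4s_{1/2}>3s_0+s_1\qquad\text{and}\qquad \cos\frac{\pi}{2N}>\max\{l_1,l_2\},$$ where $l_1$ is the smaller root of the equation $$2s_0z^2-4s_{1/2}z+s_0+s_1=0,$$ and $l_2$ is the second root (the middle one of the three real roots in increasing order) of the equation $$-6s_1z^3+4s_{1/2}z^2+(s_0+9s_1)z-8s_{1/2}=0.$$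
   Context: Work in $\mathbb{R}^2$. $\Omega_{(\epsilon,\tau)}=\{x\in\mathbb{R}^2:\epsilon\le|x|\le\epsilon+\tau\}$. Reference element: $\hat T=\{(\hat x_1,\hat x_2):\hat x_1,\hat x_2\ge 0,\ \hat x_1+\hat x_2\le 1\}$ with barycentric coordinates $\hat\lambda_1=1-\hat x_1-\hat x_2$, $\hat\lambda_2=\hat x_1$, $\hat\lambda_3=\hat x_2$, and quadratic shape functions $\hat\mu_i=\hat\lambda_i(2\hat\lambda_i-1)$ ($1\le i\le 3$), $\hat\mu_{ij}=4\hat\lambda_i\hat\lambda_j$ ($1\le i<j\le 3$). Curved triangle: three vertices $a_1,a_2,a_3$ given in polar coordinates $a_i=(r(a_i),\theta(a_i))$ determine edge nodes $a_{ij}$ ($i<j$) with polar coordinates $\left(\frac{r(a_i)+r(a_j)}{2},\frac{\theta(a_i)+\theta(a_j)}{2}\right)$, and the mapping $F_T(\hat x)=\sum_{i=1}^3 a_i\hat\mu_i(\hat x)+\sum_{1\le i<j\le 3}a_{ij}\hat\mu_{ij}(\hat x)$; the element is $T=F_T(\hat T)$. Types A and B elements: for $i=0,1,\dots,N-1$, the type A element $A_i$ has vertices in polar coordinates (radius, angle) $a_1=(\epsilon,\tfrac{2i\pi}{N})$, $a_2=(\epsilon+\tau,\tfrac{(2i-1)\pi}{N})$, $a_3=(\epsilon+\tau,\tfrac{(2i+1)\pi}{N})$; the type B element $B_i$ has vertices $a_1=(\epsilon+\tau,\tfrac{(2i+1)\pi}{N})$, $a_2=(\epsilon,\tfrac{2(i+1)\pi}{N})$,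 $a_3=(\epsilon,\tfrac{2i\pi}{N})$. Thus there are $N$ evenly spaced nodes on each of the two circles and $2N$ elements. Interpolation: for a vector field $v$, on the element $T$, $\Pi v(F_T(\hat x))=\sum_{i=1}^3 v(a_i)\hat\mu_i(\hat x)+\sum_{1\le i<j\le 3}v(a_{ij})\hat\mu_{ij}(\hat x)$, $\hat x\in\hat T$. *)

theory Defs
  imports "HOL-Analysis.Analysis"
begin

definition ref_triangle :: "(real^2) set" where
  "ref_triangle = {x. 0 \<le> x $ 1 \<and> 0 \<le> x $ 2 \<and> x $ 1 + x $ 2 \<le> 1}"

text \<open>Node indices range over \<open>{1..3}\<close>, here and below.\<close>

definition bary :: "nat \<Rightarrow> real^2 \<Rightarrow> real" where
  "bary i x = (if i = 1 then 1 - x $ 1 - x $ 2 else if i = 2 then x $ 1 else x $ 2)"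

definition vertex_shape :: "nat \<Rightarrow> real^2 \<Rightarrow> real" where
  "vertex_shape i x = bary i x * (2 * bary i x - 1)"

definition edge_shape :: "nat \<Rightarrow> nat \<Rightarrow> real^2 \<Rightarrow> real" where
  "edge_shape i j x = 4 * bary i x * bary j x"

definition quadratic_comb ::
    "(nat \<Rightarrow> real^2) \<Rightarrow> (nat \<Rightarrow> nat \<Rightarrow> real^2) \<Rightarrow> real^2 \<Rightarrow> real^2" where
  "quadratic_comb c d x =
     (\<Sum>i\<in>{1..3}. vertex_shape i x *\<^sub>R c i) +
     (\<Sum>i\<in>{1..3}. \<Sum>j\<in>{i<..3}. edge_shape i j x *\<^sub>R d i j)"

text \<open>
  The vertices of a curved triangle are given by polar coordinates (radius, angle), not by points:
  the edge nodes are obtained by averaging these coordinates, so the choice of angle modulo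
  \<open>2 * pi\<close> matters.
\<close>

definition polar_point :: "real \<times> real \<Rightarrow> real^2" where
  "polar_point p = vector [fst p * cos (snd p), fst p * sin (snd p)]"

definition edge_node :: "real \<times> real \<Rightarrow> real \<times> real \<Rightarrow> real \<times> real" where
  "edge_node p q = ((fst p + fst q) / 2, (snd p + snd q) / 2)"

text \<open>The map \<open>F\<^sub>T\<close>; the curved triangle \<open>T\<close> is the image of \<open>ref_triangle\<close> under it.\<close>

definition iso_map :: "(nat \<Rightarrow> real \<times> real) \<Rightarrow> real^2 \<Rightarrow> real^2" where
  "iso_map a = quadratic_comb (\<lambda>i. polar_point (a i)) (\<lambda>i j. polar_point (edge_node (a i) (a j)))"

text \<open>
  The composition of the interpolant of \<open>v\<close> with \<open>F\<^sub>T\<close>, as a function of the reference variable.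
  The interpolant is defined through this composition, so no injectivity of \<open>F\<^sub>T\<close> is needed here.
\<close>

definition interp_comp ::
    "(real^2 \<Rightarrow> real^2) \<Rightarrow> (nat \<Rightarrow> real \<times> real) \<Rightarrow> real^2 \<Rightarrow> real^2" where
  "interp_comp v a =
     quadratic_comb (\<lambda>i. v (polar_point (a i))) (\<lambda>i j. v (polar_point (edge_node (a i) (a j))))"

lemma iso_map_eq_interp_comp: "iso_map a = interp_comp (\<lambda>x. x) a"
  by (simp add: iso_map_def interp_comp_def)

definition type_A :: "real \<Rightarrow> real \<Rightarrow> nat \<Rightarrow> nat \<Rightarrow> nat \<Rightarrow> real \<times> real" where
  "type_A \<epsilon> \<tau> N i k =
     (if k = 1 then (\<epsilon>, 2 * real i * pi / real N)
      else if k = 2 then (\<epsilon> + \<tau>, (2 * real i - 1) * pi / real N)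
      else (\<epsilon> + \<tau>, (2 * real i + 1) * pi / real N))"

definition type_B :: "real \<Rightarrow> real \<Rightarrow> nat \<Rightarrow> nat \<Rightarrow> nat \<Rightarrow> real \<times> real" where
  "type_B \<epsilon> \<tau> N i k =
     (if k = 1 then (\<epsilon> + \<tau>, (2 * real i + 1) * pi / real N)
      else if k = 2 then (\<epsilon>, 2 * (real i + 1) * pi / real N)
      else (\<epsilon>, 2 * real i * pi / real N))"

definition radial_field :: "(real \<Rightarrow> real) \<Rightarrow> real^2 \<Rightarrow> real^2" where
  "radial_field s x = (s (norm x) / norm x) *\<^sub>R x"

definition is_smaller_root :: "(real \<Rightarrow> real) \<Rightarrow> real \<Rightarrow> bool" where
  "is_smaller_root f z \<longleftrightarrow> (\<exists>w. {x. f x = 0} = {z, w} \<and> z \<le> w)"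

definition is_middle_root :: "(real \<Rightarrow> real) \<Rightarrow> real \<Rightarrow> bool" where
  "is_middle_root f z \<longleftrightarrow> (\<exists>u w. {x. f x = 0} = {u, z, w} \<and> u < z \<and> z < w)"

end

theory Submission
  imports Defs
begin

text \<open>
  Every element is symmetric about the ray through its vertex \<open>a\<^sub>1\<close>, and so is the
  interpolated field, because it is radial.  Up to a rotation, which leaves determinants alone, the
  interpolant is therefore determined by five numbers: the values \<open>p\<close> at the apex \<open>a\<^sub>1\<close>, \<open>q\<close> on the
  opposite circle and \<open>h\<close> halfway between, and the cosine and sine of the angle
  \<open>\<beta> = \<plusminus> \<pi> / (2 N)\<close> from the axis to the lateral edge nodes.  In the coordinates \<open>u = x\<^sub>1 + x\<^sub>2\<close> (distance from the apex) and
  \<open>w = x\<^sub>2 - x\<^sub>1\<close> (offset from the axis) the component of the interpolant along the axis is a function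
  of \<open>u\<close> plus a multiple of \<open>w\<^sup>2\<close>, and the other component is \<open>w\<close> times an affine function of \<open>u\<close>.
  Hence the Jacobian is \<open>4 sin \<beta>\<close> times \<open>jac_factor\<close>, a product of two affine functions of \<open>u\<close> plus
  \<open>8 q (1 - z\<^sup>2) (q z - h) w\<^sup>2\<close> with \<open>z = cos \<beta>\<close> (lemma
  \<open>det_jacobian_symmetric_element\<close>).  Type A has apex value \<open>s\<^sub>0\<close>; type B has apex value \<open>s\<^sub>1\<close> and the
  opposite orientation.  Below, \<open>a, h, b\<close> stand for \<open>s\<^sub>0, s\<^sub>h, s\<^sub>1\<close>.

  Being affine in \<open>w\<^sup>2\<close>, the factor is extremal on the axis \<open>w = 0\<close> or on the sides \<open>\<bar>w\<bar> = u\<close>.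

  On type B elements the coefficient of \<open>w\<^sup>2\<close> is negative, which is the favourable sign, so only the
  axis matters.  There both affine functions are controlled by their values at \<open>u = 0\<close> and \<open>u = 1\<close>,
  and everything follows from the sign of one of these values, the quadratic \<open>inner_quad a h b z\<close>,
  which belongs to the midpoint \<open>u = 1\<close>, \<open>w = 0\<close> of the inner arc.

  On type A elements, once that quadratic is negative, everything on the axis is fine.  If
  \<open>b z \<ge> h\<close>, the \<open>w\<^sup>2\<close> term helps.  If \<open>b z < h\<close>, the worst case is on the sides, where the
  factor is a concave quadratic in \<open>u\<close>; so it suffices to look at the apex and at the outer vertices,
  and at the latter it equals \<open>b\<close> times the cubic \<open>outer_cubic a h b z\<close>.

  Positivity on all elements is thus equivalent to the quadratic being negative and the cubic
  positive at \<open>z\<close>.  Finally the roots are located with the intermediate value theorem: the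
  quadratic is positive at \<open>0\<close>, and on \<open>[0,1)\<close> it decreases to the value \<open>3 a + b - 4 h\<close> at \<open>1\<close>,
  whereas the cubic always has one root below \<open>0\<close>, one in \<open>(0,1)\<close> and one above \<open>1\<close>.
\<close>

section \<open>The Jacobian of a quadratic interpolant\<close>

lemma quadratic_comb_expand:
  "quadratic_comb c d x =
     vertex_shape 1 x *\<^sub>R c 1 + vertex_shape 2 x *\<^sub>R c 2 + vertex_shape 3 x *\<^sub>R c 3 +
     edge_shape 1 2 x *\<^sub>R d 1 2 + edge_shape 1 3 x *\<^sub>R d 1 3 + edge_shape 2 3 x *\<^sub>R d 2 3"
proof -
  have "{1..3} = {1, 2, 3 :: nat}" "{1<..3} = {2, 3 :: nat}" "{2<..3} = {3 :: nat}"
    by auto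
  then show ?thesis
    by (simp add: quadratic_comb_def)
qed

definition quadratic_comb_d1 ::
    "(nat \<Rightarrow> real^2) \<Rightarrow> (nat \<Rightarrow> nat \<Rightarrow> real^2) \<Rightarrow> real^2 \<Rightarrow> real^2" where
  "quadratic_comb_d1 c d x =
     (1 - 4 * bary 1 x) *\<^sub>R c 1 + (4 * bary 2 x - 1) *\<^sub>R c 2 +
     (4 * (bary 1 x - bary 2 x)) *\<^sub>R d 1 2 - (4 * bary 3 x) *\<^sub>R d 1 3 + (4 * bary 3 x) *\<^sub>R d 2 3"

definition quadratic_comb_d2 ::
    "(nat \<Rightarrow> real^2) \<Rightarrow> (nat \<Rightarrow> nat \<Rightarrow> real^2) \<Rightarrow> real^2 \<Rightarrow> real^2" where
  "quadratic_comb_d2 c d x =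
     (1 - 4 * bary 1 x) *\<^sub>R c 1 + (4 * bary 3 x - 1) *\<^sub>R c 3 +
     (4 * (bary 1 x - bary 3 x)) *\<^sub>R d 1 3 - (4 * bary 2 x) *\<^sub>R d 1 2 + (4 * bary 2 x) *\<^sub>R d 2 3"

lemma has_derivative_quadratic_comb:
  "(quadratic_comb c d has_derivative
     (\<lambda>v. v $ 1 *\<^sub>R quadratic_comb_d1 c d x + v $ 2 *\<^sub>R quadratic_comb_d2 c d x)) (at x)"
proof -
  note [derivative_intros] = bounded_linear.has_derivative[OF bounded_linear_vec_nth]
  have "((\<lambda>x. quadratic_comb c d x) has_derivative
     (\<lambda>v. v $ 1 *\<^sub>R quadratic_comb_d1 c d x + v $ 2 *\<^sub>R quadratic_comb_d2 c d x)) (at x)"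
    unfolding quadratic_comb_expand vertex_shape_def edge_shape_def bary_def
    apply simp
    apply (rule derivative_eq_intros refl)+
    apply (rule ext)
    apply (simp add: vec_eq_iff quadratic_comb_d1_def quadratic_comb_d2_def bary_def algebra_simps)
    done
  then show ?thesis by simp
qed

lemma det_jacobian_quadratic_comb:
  "det (jacobian (quadratic_comb c d) (at x)) =
     quadratic_comb_d1 c d x $ 1 * quadratic_comb_d2 c d x $ 2 -
     quadratic_comb_d1 c d x $ 2 * quadratic_comb_d2 c d x $ 1"
  by (simp add: jacobian_def matrix_def det_2 axis_def
      frechet_derivative_at[OF has_derivative_quadratic_comb, symmetric])

lemma polar_point_nth [simp]:
  "polar_point p $ 1 = fst p * cos (snd p)" "polar_point p $ 2 = fst p * sin (snd p)"
  by (simp_all add: polar_point_def)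

lemma radial_field_polar_point:
  assumes "r > 0"
  shows "radial_field s (polar_point (r, t)) = polar_point (s r, t)"
proof -
  have "norm (polar_point (r, t)) = r"
    using assms
    by (simp add: norm_vec_def L2_set_def sum_2 power_mult_distrib flip: distrib_left)
  with assms show ?thesis
    by (simp add: radial_field_def vec_eq_iff forall_2)
qed

text \<open>
  For nodal values \<open>p\<close> (apex), \<open>q\<close> (base) and \<open>h\<close> (lateral edges) on an element whose axis is the
  first coordinate axis, \<open>axial_slope\<close> is the derivative in \<open>u\<close> of the first component of the
  interpolant at \<open>z = cos \<beta>\<close>; here \<open>2 * z\<^sup>2 - 1\<close> is \<open>cos (2 * \<beta>)\<close>.  The second component is
  \<open>2 * sin \<beta> * w * transverse_slope q h z u\<close>.
\<close>

definition axial_slope :: "real \<Rightarrow> real \<Rightarrow> real \<Rightarrow> real \<Rightarrow> real \<Rightarrow> real" where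
  "axial_slope p q h z u =
     p * (4 * u - 3) + q * (2 * z^2 - 1) * (2 * u - 1) + 4 * h * z * (1 - 2 * u) + 2 * q * u"

definition transverse_slope :: "real \<Rightarrow> real \<Rightarrow> real \<Rightarrow> real \<Rightarrow> real" where
  "transverse_slope q h z u = q * z * (2 * u - 1) + 2 * h * (1 - u)"

text \<open>
  The \<open>w\<^sup>2\<close> term comes from the off-diagonal entries: the derivative of the first component in \<open>w\<close> is
  \<open>- 4 * w * q * (1 - z\<^sup>2)\<close>, that of the second in \<open>u\<close> is \<open>2 * sin \<beta> * w * (2 * q * z - 2 * h)\<close>.
  One factor \<open>2 * sin \<beta>\<close> and the Jacobian \<open>2\<close> of the change of variables are split off.
\<close>

definition jac_factor :: "real \<Rightarrow> real \<Rightarrow> real \<Rightarrow> real \<Rightarrow> real \<Rightarrow> real \<Rightarrow> real" where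
  "jac_factor p q h z u w =
     axial_slope p q h z u * transverse_slope q h z u + 8 * w^2 * q * (1 - z^2) * (q * z - h)"

text \<open>
  Expanding the nodes around the axis direction \<open>t\<close> writes both partial derivatives as rotations by
  \<open>t\<close> of vectors \<open>(U, y * V)\<close> that do not involve \<open>t\<close>, and the rotation drops out of the
  determinant.  The angle \<open>b\<close> may be negative, so that one formula serves elements of either
  orientation.
\<close>

lemma det_jacobian_symmetric_element:
  assumes c: "c 1 = polar_point (p, t)" "c 2 = polar_point (q, t - 2 * b)"
      "c 3 = polar_point (q, t + 2 * b)"
    and d: "d 1 2 = polar_point (h, t - b)" "d 1 3 = polar_point (h, t + b)"
      "d 2 3 = polar_point (q, t)"
  shows "det (jacobian (quadratic_comb c d) (at x)) =
     4 * sin b * jac_factor p q h (cos b) (x $ 1 + x $ 2) (x $ 2 - x $ 1)"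
proof -
  define C S where "C = cos t" and "S = sin t"
  define z y where "z = cos b" and "y = sin b"
  have CS: "C\<^sup>2 + S\<^sup>2 = 1" and zy: "y\<^sup>2 = 1 - z\<^sup>2"
    by (simp_all add: C_def S_def z_def y_def sin_squared_eq)
  define x1 x2 x3 where "x1 = bary 1 x" and "x2 = x $ 1" and "x3 = x $ 2"
  have x1: "x1 = 1 - x2 - x3"
    by (simp add: x1_def x2_def x3_def bary_def)
  have bs: "bary 1 x = x1" "bary 2 x = x2" "bary 3 x = x3"
    by (simp_all add: x1_def x2_def x3_def bary_def)
  \<comment> \<open>Components of the two partial derivatives along and across the axis; \<open>y\<close> is split off the latter.\<close>
  define U1 U2 where
    "U1 = (1 - 4 * x1) * p + (4 * x2 - 1) * q * (2 * z\<^sup>2 - 1) + 4 * (x1 - x2) * h * z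
            - 4 * x3 * h * z + 4 * x3 * q" and
    "U2 = (1 - 4 * x1) * p + (4 * x3 - 1) * q * (2 * z\<^sup>2 - 1) + 4 * (x1 - x3) * h * z
            - 4 * x2 * h * z + 4 * x2 * q"
  define V1 V2 where
    "V1 = - ((4 * x2 - 1) * q * 2 * z + 4 * (x1 - x2) * h + 4 * x3 * h)" and
    "V2 = (4 * x3 - 1) * q * 2 * z + 4 * (x1 - x3) * h + 4 * x2 * h"
  have angles: "cos (t - b) = C * z + S * y" "sin (t - b) = S * z - C * y"
      "cos (t + b) = C * z - S * y" "sin (t + b) = S * z + C * y"
      "cos (t - 2 * b) = C * (2 * z\<^sup>2 - 1) + S * (2 * y * z)"
      "sin (t - 2 * b) = S * (2 * z\<^sup>2 - 1) - C * (2 * y * z)"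
      "cos (t + 2 * b) = C * (2 * z\<^sup>2 - 1) - S * (2 * y * z)"
      "sin (t + 2 * b) = S * (2 * z\<^sup>2 - 1) + C * (2 * y * z)"
    by (simp_all add: C_def S_def z_def y_def cos_diff sin_diff cos_add sin_add
        cos_double_cos[of b] sin_double[of b])
  let ?D1 = "quadratic_comb_d1 c d x" and ?D2 = "quadratic_comb_d2 c d x"
  have D: "?D1 $ 1 = C * U1 - S * (y * V1)" "?D1 $ 2 = S * U1 + C * (y * V1)"
      "?D2 $ 1 = C * U2 - S * (y * V2)" "?D2 $ 2 = S * U2 + C * (y * V2)"
    unfolding quadratic_comb_d1_def quadratic_comb_d2_def bs vector_add_component
      vector_minus_component vector_scaleR_component real_scaleR_def c d polar_point_nth
      fst_conv snd_conv angles C_def[symmetric] S_def[symmetric] U1_def U2_def V1_def V2_def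
    by (simp_all add: algebra_simps)
  have "?D1 $ 1 * ?D2 $ 2 - ?D1 $ 2 * ?D2 $ 1 = (C\<^sup>2 + S\<^sup>2) * (y * (U1 * V2 - U2 * V1))"
    unfolding D by algebra
  also have "\<dots> = y * (U1 * V2 - U2 * V1)"
    by (simp add: CS)
  also have "U1 * V2 - U2 * V1 = 4 * jac_factor p q h z (x2 + x3) (x3 - x2)"
    unfolding U1_def U2_def V1_def V2_def x1 jac_factor_def axial_slope_def transverse_slope_def
    by algebra
  finally show ?thesis
    by (simp add: det_jacobian_quadratic_comb z_def y_def x2_def x3_def)
qed

lemma det_jacobian_type_A:
  assumes "\<epsilon> > 0" "\<tau> > 0" "N \<ge> 1"
  shows "det (jacobian (interp_comp (radial_field s) (type_A \<epsilon> \<tau> N i)) (at x)) =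
     4 * sin (pi / (2 * real N)) * jac_factor (s \<epsilon>) (s (\<epsilon> + \<tau>)) (s (\<epsilon> + \<tau> / 2))
       (cos (pi / (2 * real N))) (x $ 1 + x $ 2) (x $ 2 - x $ 1)"
proof -
  define t b where "t = 2 * real i * pi / real N" and "b = pi / (2 * real N)"
  have vertices: "type_A \<epsilon> \<tau> N i 1 = (\<epsilon>, t)" "type_A \<epsilon> \<tau> N i 2 = (\<epsilon> + \<tau>, t - 2 * b)"
      "type_A \<epsilon> \<tau> N i 3 = (\<epsilon> + \<tau>, t + 2 * b)"
    using \<open>N \<ge> 1\<close> by (simp_all add: type_A_def t_def b_def field_simps)
  have nodes: "edge_node (\<epsilon>, t) (\<epsilon> + \<tau>, t - 2 * b) = (\<epsilon> + \<tau> / 2, t - b)"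
      "edge_node (\<epsilon>, t) (\<epsilon> + \<tau>, t + 2 * b) = (\<epsilon> + \<tau> / 2, t + b)"
      "edge_node (\<epsilon> + \<tau>, t - 2 * b) (\<epsilon> + \<tau>, t + 2 * b) = (\<epsilon> + \<tau>, t)"
    by (simp_all add: edge_node_def field_simps)
  have "0 < \<epsilon> + \<tau>" "0 < \<epsilon> + \<tau> / 2"
    using assms by simp_all
  with \<open>\<epsilon> > 0\<close> show ?thesis
    unfolding interp_comp_def b_def[symmetric]
    by (intro det_jacobian_symmetric_element[where t = t])
      (simp_all only: vertices nodes radial_field_polar_point)
qed

text \<open>
  Seen from its apex on the outer circle, the element runs through its base in the direction
  opposite to type A, so \<open>\<beta>\<close> is negative and the sign flips.
\<close>

lemma det_jacobian_type_B:
  assumes "\<epsilon> > 0" "\<tau> > 0" "N \<ge> 1"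
  shows "det (jacobian (interp_comp (radial_field s) (type_B \<epsilon> \<tau> N i)) (at x)) =
     - (4 * sin (pi / (2 * real N)) * jac_factor (s (\<epsilon> + \<tau>)) (s \<epsilon>) (s (\<epsilon> + \<tau> / 2))
       (cos (pi / (2 * real N))) (x $ 1 + x $ 2) (x $ 2 - x $ 1))"
proof -
  define t b where "t = (2 * real i + 1) * pi / real N" and "b = - (pi / (2 * real N))"
  have vertices: "type_B \<epsilon> \<tau> N i 1 = (\<epsilon> + \<tau>, t)" "type_B \<epsilon> \<tau> N i 2 = (\<epsilon>, t - 2 * b)"
      "type_B \<epsilon> \<tau> N i 3 = (\<epsilon>, t + 2 * b)"
    using \<open>N \<ge> 1\<close> by (simp_all add: type_B_def t_def b_def field_simps)
  have nodes: "edge_node (\<epsilon> + \<tau>, t) (\<epsilon>, t - 2 * b) = (\<epsilon> + \<tau> / 2, t - b)"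
      "edge_node (\<epsilon> + \<tau>, t) (\<epsilon>, t + 2 * b) = (\<epsilon> + \<tau> / 2, t + b)"
      "edge_node (\<epsilon>, t - 2 * b) (\<epsilon>, t + 2 * b) = (\<epsilon>, t)"
    by (simp_all add: edge_node_def field_simps)
  have "0 < \<epsilon> + \<tau>" "0 < \<epsilon> + \<tau> / 2"
    using assms by simp_all
  with \<open>\<epsilon> > 0\<close> have "det (jacobian (interp_comp (radial_field s) (type_B \<epsilon> \<tau> N i)) (at x)) =
     4 * sin b * jac_factor (s (\<epsilon> + \<tau>)) (s \<epsilon>) (s (\<epsilon> + \<tau> / 2)) (cos b)
       (x $ 1 + x $ 2) (x $ 2 - x $ 1)"
    unfolding interp_comp_def
    by (intro det_jacobian_symmetric_element[where t = t])
      (simp_all only: vertices nodes radial_field_polar_point)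
  then show ?thesis
    by (simp add: b_def)
qed

section \<open>Sign of the Jacobian on a sector\<close>

lemma axial_slope_affine:
  "axial_slope p q h z u = (1 - u) * axial_slope p q h z 0 + u * axial_slope p q h z 1"
  by (simp add: axial_slope_def algebra_simps)

lemma transverse_slope_affine:
  "transverse_slope q h z u = (1 - u) * transverse_slope q h z 0 + u * transverse_slope q h z 1"
  by (simp add: transverse_slope_def algebra_simps)

lemma affine_comb_pos:
  fixes u a b :: real
  assumes "0 \<le> u" "u \<le> 1" "a > 0" "b > 0"
  shows "(1 - u) * a + u * b > 0"
proof (cases "u = 0")
  case False
  with assms show ?thesis
    by (intro add_nonneg_pos) auto
qed (use assms in simp)

text \<open>
  Both functions are values on the base \<open>u = 1\<close>: \<open>inner_quad a h b\<close> is the axial slope of a type B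
  element there (and, with \<open>a\<close> and \<open>b\<close> exchanged, of a type A element), and \<open>b\<close> times
  \<open>outer_cubic a h b\<close> is the Jacobian factor at the outer vertices of a type A element.
\<close>

definition inner_quad :: "real \<Rightarrow> real \<Rightarrow> real \<Rightarrow> real \<Rightarrow> real" where
  "inner_quad a h b z = 2 * a * z^2 - 4 * h * z + a + b"

definition outer_cubic :: "real \<Rightarrow> real \<Rightarrow> real \<Rightarrow> real \<Rightarrow> real" where
  "outer_cubic a h b z = - 6 * b * z^3 + 4 * h * z^2 + (a + 9 * b) * z - 8 * h"

lemma axial_slope_1: "axial_slope p q h z 1 = inner_quad q h p z"
  by (simp add: axial_slope_def inner_quad_def algebra_simps)

lemma outer_cubic_eq:
  "outer_cubic a h b z = z * inner_quad b h a z + 8 * (1 - z\<^sup>2) * (b * z - h)"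
  by (simp add: outer_cubic_def inner_quad_def algebra_simps power2_eq_square power3_eq_cube)

text \<open>
  Of the profile \<open>s\<close> the argument retains only that its values at three equidistant radii are
  positive, increasing and convex.
\<close>

locale convex_radii =
  fixes a h b :: real
  assumes a_pos: "0 < a" and a_less_h: "a < h" and h_less_b: "h < b"
    and convex: "2 * h \<le> a + b"
begin

lemma inner_quad_strict_antimono:
  assumes "x < y" "y \<le> 1"
  shows "inner_quad a h b y < inner_quad a h b x"
proof -
  have "inner_quad a h b x - inner_quad a h b y = 2 * (y - x) * (2 * h - a * (x + y))"
    by (simp add: inner_quad_def algebra_simps power2_eq_square)
  moreover have "a * (x + y) < a * 2"
    using a_pos assms by (intro mult_strict_left_mono) auto
  then have "2 * (y - x) * (2 * h - a * (x + y)) > 0"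
    using assms a_less_h by (intro mult_pos_pos) auto
  ultimately show ?thesis by linarith
qed

text \<open>
  Necessity is read off at \<open>u = 1\<close>, \<open>w = 0\<close>.  For sufficiency, \<open>a * z < h\<close> makes the \<open>w\<^sup>2\<close> term
  nonpositive, and on the axis the first affine factor is negative and the second positive at
  both ends.  The end \<open>u = 0\<close> of the first factor is harmless because convexity and
  \<open>h < b\<close> give \<open>4 * h < a + 3 * b\<close>.
\<close>

lemma type_B_condition:
  assumes z: "0 \<le> z" "z < 1"
  shows "(\<forall>u w. 0 \<le> u \<longrightarrow> u \<le> 1 \<longrightarrow> \<bar>w\<bar> \<le> u \<longrightarrow> jac_factor b a h z u w < 0) \<longleftrightarrow>
           inner_quad a h b z < 0"
proof
  assume "\<forall>u w. 0 \<le> u \<longrightarrow> u \<le> 1 \<longrightarrow> \<bar>w\<bar> \<le> u \<longrightarrow> jac_factor b a h z u w < 0"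
  then have "jac_factor b a h z 1 0 < 0"
    by auto
  then have "inner_quad a h b z * (a * z) < 0"
    by (simp add: jac_factor_def axial_slope_1 transverse_slope_def)
  then show "inner_quad a h b z < 0"
    using z a_pos by (auto simp: mult_less_0_iff)
next
  assume neg: "inner_quad a h b z < 0"
  have z0: "z > 0"
    using neg z a_pos a_less_h h_less_b by (cases "z = 0") (auto simp: inner_quad_def)
  have "inner_quad a h b 1 < inner_quad a h b z"
    using z by (intro inner_quad_strict_antimono) auto
  have az: "a * z < h"
    using mult_strict_left_mono[of z 1 a] z a_pos a_less_h by linarith
  have "- axial_slope b a h z 0 = (inner_quad a h b z - inner_quad a h b 1) + (a + 3 * b - 4 * h)"
    by (simp add: axial_slope_def inner_quad_def algebra_simps)
  then have X0: "- axial_slope b a h z 0 > 0"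
    using \<open>inner_quad a h b 1 < inner_quad a h b z\<close> convex h_less_b by linarith
  show "\<forall>u w. 0 \<le> u \<longrightarrow> u \<le> 1 \<longrightarrow> \<bar>w\<bar> \<le> u \<longrightarrow> jac_factor b a h z u w < 0"
  proof (intro allI impI)
    fix u w :: real
    assume u: "0 \<le> u" "u \<le> 1"
    have "- axial_slope b a h z u > 0"
      using affine_comb_pos[OF u X0, of "- inner_quad a h b z"] neg
      by (subst axial_slope_affine) (simp add: axial_slope_1)
    moreover have "transverse_slope a h z u > 0"
      using affine_comb_pos[OF u, of "2 * h - a * z" "a * z"] az z0 a_pos a_less_h
      by (subst transverse_slope_affine) (simp add: transverse_slope_def)
    ultimately have "axial_slope b a h z u * transverse_slope a h z u < 0"
      by (simp add: mult_neg_pos)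
    moreover have "8 * w\<^sup>2 * a * (1 - z\<^sup>2) * (a * z - h) \<le> 0"
      using az z a_pos by (intro mult_nonneg_nonpos mult_nonneg_nonneg) (auto simp: power_le_one)
    ultimately show "jac_factor b a h z u w < 0"
      unfolding jac_factor_def by (rule add_neg_nonpos)
  qed
qed

text \<open>
  Necessity is read off at an outer vertex, \<open>u = w = 1\<close>.  For sufficiency, both affine factors are
  positive at both ends: at \<open>u = 0\<close> this uses the condition from type B and \<open>b < 2 * h\<close>, and at
  \<open>u = 1\<close> the quadratic \<open>inner_quad b h a\<close> has negative discriminant, since
  \<open>2 * h\<^sup>2 < b * (a + b)\<close>.  This settles the case \<open>h \<le> b * z\<close>, in which the \<open>w\<^sup>2\<close> term is
  nonnegative.  Otherwise the minimum over \<open>w\<close> is attained at \<open>\<bar>w\<bar> = u\<close>, where the factor is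
  concave in \<open>u\<close> because \<open>2 * h * z \<le> a + b\<close>.
\<close>

lemma type_A_condition:
  assumes z: "0 \<le> z" "z < 1" and bound: "b < 2 * h" and neg: "inner_quad a h b z < 0"
  shows "(\<forall>u w. 0 \<le> u \<longrightarrow> u \<le> 1 \<longrightarrow> \<bar>w\<bar> \<le> u \<longrightarrow> jac_factor a b h z u w > 0) \<longleftrightarrow>
           outer_cubic a h b z > 0"
proof -
  have b_pos: "b > 0"
    using a_pos a_less_h h_less_b by simp
  have z0: "z > 0"
    using neg z a_pos a_less_h h_less_b by (cases "z = 0") (auto simp: inner_quad_def)
  have z2: "0 < 1 - z\<^sup>2"
    using z by (simp add: abs_square_less_1)
  have bz: "b * z < 2 * h"
    using mult_strict_left_mono[of z 1 b] z b_pos bound by linarith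
  have "axial_slope a b h z 0 = - inner_quad a h b z + 2 * (b - a) * (1 - z\<^sup>2)"
    by (simp add: axial_slope_def inner_quad_def algebra_simps)
  moreover have "2 * (b - a) * (1 - z\<^sup>2) > 0"
    using a_less_h h_less_b z2 by (intro mult_pos_pos) auto
  ultimately have X0: "axial_slope a b h z 0 > 0"
    using neg by linarith
  have "b * inner_quad b h a z = 2 * (b * z - h)\<^sup>2 + (b * (a + b) - 2 * h * h)"
    by (simp add: inner_quad_def algebra_simps power2_eq_square)
  moreover have "h * (2 * h) < b * (a + b)"
    using a_pos a_less_h h_less_b convex by (intro mult_less_le_imp_less) auto
  ultimately have "b * inner_quad b h a z > 0"
    by (simp add: add_nonneg_pos)
  then have X1: "inner_quad b h a z > 0"
    using b_pos by (simp add: zero_less_mult_iff)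
  have X: "axial_slope a b h z u > 0" if u: "0 \<le> u" "u \<le> 1" for u
    using affine_comb_pos[OF u X0 X1] by (subst axial_slope_affine) (simp add: axial_slope_1)
  have G: "transverse_slope b h z u > 0" if u: "0 \<le> u" "u \<le> 1" for u
    using affine_comb_pos[OF u, of "2 * h - b * z" "b * z"] bz z0 b_pos
    by (subst transverse_slope_affine) (simp add: transverse_slope_def)
  have corner: "jac_factor a b h z 1 1 = b * outer_cubic a h b z"
    by (simp add: jac_factor_def axial_slope_1 transverse_slope_def outer_cubic_eq algebra_simps)
  show ?thesis
  proof
    assume "\<forall>u w. 0 \<le> u \<longrightarrow> u \<le> 1 \<longrightarrow> \<bar>w\<bar> \<le> u \<longrightarrow> jac_factor a b h z u w > 0"
    then have "jac_factor a b h z 1 1 > 0"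
      by auto
    then show "outer_cubic a h b z > 0"
      using b_pos by (simp add: corner zero_less_mult_iff)
  next
    assume cubic: "outer_cubic a h b z > 0"
    show "\<forall>u w. 0 \<le> u \<longrightarrow> u \<le> 1 \<longrightarrow> \<bar>w\<bar> \<le> u \<longrightarrow> jac_factor a b h z u w > 0"
    proof (intro allI impI)
      fix u w :: real
      assume u: "0 \<le> u" "u \<le> 1" and w: "\<bar>w\<bar> \<le> u"
      show "jac_factor a b h z u w > 0"
      proof (cases "h \<le> b * z")
        case True
        show ?thesis
          unfolding jac_factor_def
        proof (rule add_pos_nonneg)
          show "axial_slope a b h z u * transverse_slope b h z u > 0"
            by (intro mult_pos_pos X G u)
          show "8 * w\<^sup>2 * b * (1 - z\<^sup>2) * (b * z - h) \<ge> 0"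
            using z2 b_pos True by (intro mult_nonneg_nonneg) auto
        qed
      next
        case False
        have "w\<^sup>2 \<le> u\<^sup>2"
          using w u by (simp add: abs_le_square_iff[symmetric])
        then have "8 * w\<^sup>2 * b * (1 - z\<^sup>2) * (h - b * z) \<le> 8 * u\<^sup>2 * b * (1 - z\<^sup>2) * (h - b * z)"
          using z2 b_pos False by (intro mult_right_mono) auto
        then have "jac_factor a b h z u u \<le> jac_factor a b h z u w"
          by (simp add: jac_factor_def algebra_simps)
        \<comment> \<open>A quadratic equals its chord plus \<open>u * (1 - u)\<close> times minus its leading coefficient.\<close>
        moreover have "jac_factor a b h z u u =
            (1 - u) * jac_factor a b h z 0 0 + u * jac_factor a b h z 1 1
            + 8 * (u * (1 - u)) * ((h - b * z) * (a + b - 2 * h * z))"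
          by (simp add: jac_factor_def axial_slope_def transverse_slope_def power2_eq_square
              algebra_simps)
        moreover have "(1 - u) * jac_factor a b h z 0 0 + u * jac_factor a b h z 1 1 > 0"
          using X[of 0] G[of 0] cubic b_pos corner
          by (intro affine_comb_pos u) (auto simp: jac_factor_def)
        moreover have "2 * h * z \<le> a + b"
          using mult_left_mono[of z 1 "2 * h"] z a_pos a_less_h convex by linarith
        then have "8 * (u * (1 - u)) * ((h - b * z) * (a + b - 2 * h * z)) \<ge> 0"
          using u False by (intro mult_nonneg_nonneg) auto
        ultimately show ?thesis
          by linarith
      qed
    qed
  qed
qed

section \<open>Location of the roots\<close>

lemma inner_quad_roots:
  assumes "inner_quad a h b 1 < 0"
  obtains r r' where "r < 1" "1 < r'"
    "\<And>x. inner_quad a h b x = 2 * a * ((x - r) * (x - r'))"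
proof -
  have "inner_quad a h b 0 > 0"
    using a_pos a_less_h h_less_b by (simp add: inner_quad_def)
  moreover have "continuous_on {0..1} (inner_quad a h b)"
    unfolding inner_quad_def by (intro continuous_intros)
  ultimately obtain r where r: "0 \<le> r" "r \<le> 1" "inner_quad a h b r = 0"
    using assms IVT2'[of "inner_quad a h b" 1 0 0] by auto
  have "r \<noteq> 1"
    using r assms by auto
  \<comment> \<open>By Vieta, the roots sum to \<open>2 * h / a\<close>, which exceeds \<open>2\<close>; so the other root lies beyond \<open>1\<close>.\<close>
  define r' where "r' = 2 * h / a - r"
  have "a * 2 < 2 * h"
    using a_less_h by simp
  then have "2 < 2 * h / a"
    using a_pos by (simp add: field_simps)
  then have "1 < r'"
    using r by (simp add: r'_def)
  have "inner_quad a h b x = 2 * a * ((x - r) * (x - r'))" for x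
  proof -
    have "a * r' = 2 * h - a * r"
      using a_pos by (simp add: r'_def field_simps)
    then show ?thesis
      using r(3) unfolding inner_quad_def by algebra
  qed
  with \<open>1 < r'\<close> \<open>r \<noteq> 1\<close> r that show ?thesis
    by force
qed

lemma less_iff_smaller_root:
  assumes "inner_quad a h b 1 < 0" "z < 1"
  shows "inner_quad a h b z < 0 \<longleftrightarrow> (\<exists>l. is_smaller_root (inner_quad a h b) l \<and> l < z)"
proof -
  obtain r r' where r: "r < 1" "1 < r'"
    and eq: "\<And>x. inner_quad a h b x = 2 * a * ((x - r) * (x - r'))"
    using inner_quad_roots[OF assms(1)] by blast
  have roots: "{x. inner_quad a h b x = 0} = {r, r'}"
    using a_pos by (auto simp: eq)
  have "is_smaller_root (inner_quad a h b) l \<longleftrightarrow> l = r" for l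
    unfolding is_smaller_root_def roots using r by (auto simp: doubleton_eq_iff)
  moreover have "inner_quad a h b z < 0 \<longleftrightarrow> r < z"
    using a_pos assms r by (auto simp: eq mult_less_0_iff)
  ultimately show ?thesis
    by simp
qed

text \<open>
  The signs at \<open>-2\<close>, \<open>0\<close>, \<open>1\<close> and \<open>2\<close> are \<open>+\<close>, \<open>-\<close>, \<open>+\<close> and \<open>-\<close> for all convex radii,
  at \<open>1\<close> because \<open>4 * h < a + 3 * b\<close>; so the middle root always exists and lies in \<open>(0,1)\<close>.
\<close>

lemma outer_cubic_roots:
  obtains r1 r2 r3 where "r1 < 0" "0 < r2" "r2 < 1" "1 < r3"
    "\<And>x. outer_cubic a h b x = - 6 * b * ((x - r1) * (x - r2) * (x - r3))"
proof -
  let ?f = "outer_cubic a h b"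
  have b_pos: "b > 0"
    using a_pos a_less_h h_less_b by simp
  have cont: "continuous_on A ?f" for A
    unfolding outer_cubic_def by (intro continuous_intros)
  have f0: "?f 0 < 0"
    using a_pos a_less_h by (simp add: outer_cubic_def)
  have f1: "?f 1 > 0"
    using convex h_less_b by (simp add: outer_cubic_def)
  have fm: "?f (-2) > 0"
    using a_pos a_less_h h_less_b by (simp add: outer_cubic_def)
  have fp: "?f 2 < 0"
    using a_pos a_less_h h_less_b by (simp add: outer_cubic_def)
  obtain r1 where r1: "-2 \<le> r1" "r1 \<le> 0" "?f r1 = 0"
    using IVT2'[of ?f 0 0 "-2"] f0 fm cont by auto
  obtain r2 where r2: "0 \<le> r2" "r2 \<le> 1" "?f r2 = 0"
    using IVT'[of ?f 0 0 1] f0 f1 cont by auto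
  obtain r3 where r3: "1 \<le> r3" "r3 \<le> 2" "?f r3 = 0"
    using IVT2'[of ?f 2 0 1] f1 fp cont by auto
  have less: "r1 < 0" "0 < r2" "r2 < 1" "1 < r3"
    using r1 r2 r3 f0 f1 by (auto simp: less_le)
  \<comment> \<open>Successive divided differences at the three roots vanish, which gives the factorisation.\<close>
  have "(r1 - r2) * (- 6 * b * (r1\<^sup>2 + r1 * r2 + r2\<^sup>2) + 4 * h * (r1 + r2) + (a + 9 * b)) = 0"
    using r1(3) r2(3) unfolding outer_cubic_def by algebra
  then have e12: "- 6 * b * (r1\<^sup>2 + r1 * r2 + r2\<^sup>2) + 4 * h * (r1 + r2) + (a + 9 * b) = 0"
    using less by simp
  have "(r3 - r2) * (- 6 * b * (r3\<^sup>2 + r3 * r2 + r2\<^sup>2) + 4 * h * (r3 + r2) + (a + 9 * b)) = 0"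
    using r3(3) r2(3) unfolding outer_cubic_def by algebra
  then have e23: "- 6 * b * (r3\<^sup>2 + r3 * r2 + r2\<^sup>2) + 4 * h * (r3 + r2) + (a + 9 * b) = 0"
    using less by simp
  have "(r1 - r3) * (- 6 * b * (r1 + r2 + r3) + 4 * h) = 0"
    using e12 e23 by algebra
  then have sum: "- 6 * b * (r1 + r2 + r3) + 4 * h = 0"
    using less by simp
  have "?f x = - 6 * b * ((x - r1) * (x - r2) * (x - r3))" for x
    using r1(3) e12 sum unfolding outer_cubic_def by algebra
  with less that show ?thesis by blast
qed

lemma greater_iff_middle_root:
  assumes "0 \<le> z" "z < 1"
  shows "outer_cubic a h b z > 0 \<longleftrightarrow> (\<exists>l. is_middle_root (outer_cubic a h b) l \<and> l < z)"
proof -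
  obtain r1 r2 r3 where r: "r1 < 0" "0 < r2" "r2 < 1" "1 < r3"
    and eq: "\<And>x. outer_cubic a h b x = - 6 * b * ((x - r1) * (x - r2) * (x - r3))"
    using outer_cubic_roots by blast
  have b_pos: "b > 0"
    using a_pos a_less_h h_less_b by simp
  have roots: "{x. outer_cubic a h b x = 0} = {r1, r2, r3}"
    using b_pos by (auto simp: eq)
  have "is_middle_root (outer_cubic a h b) l \<longleftrightarrow> l = r2" for l
  proof
    assume "is_middle_root (outer_cubic a h b) l"
    then obtain u w where uw: "{r1, r2, r3} = {u, l, w}" "u < l" "l < w"
      unfolding is_middle_root_def roots by blast
    then have "l \<in> {r1, r2, r3}" "u \<in> {r1, r2, r3}" "w \<in> {r1, r2, r3}"
      by auto
    with uw(2,3) r show "l = r2"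
      by auto
  next
    assume "l = r2"
    then show "is_middle_root (outer_cubic a h b) l"
      unfolding is_middle_root_def roots using r by (intro exI[of _ r1] exI[of _ r3]) auto
  qed
  moreover have "outer_cubic a h b z > 0 \<longleftrightarrow> r2 < z"
  proof -
    have "outer_cubic a h b z = 6 * b * (z - r1) * (r3 - z) * (z - r2)"
      by (simp add: eq algebra_simps)
    moreover have "6 * b * (z - r1) * (r3 - z) > 0"
      using b_pos assms r by (intro mult_pos_pos) auto
    ultimately show ?thesis
      by (metis diff_gt_0_iff_gt mult_pos_pos zero_less_mult_pos)
  qed
  ultimately show ?thesis
    by simp
qed

text \<open>
  The inequality \<open>4 * h > 3 * a + b\<close> says that \<open>inner_quad a h b\<close> is negative at \<open>1\<close>.  By
  monotonicity this follows from negativity at \<open>z\<close>, and it guarantees in turn that the smaller root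
  exists and lies to the left of \<open>1\<close>.
\<close>

lemma jac_factor_signs_iff:
  assumes z: "0 \<le> z" "z < 1" and bound: "b < 2 * h"
  shows "(\<forall>u w. 0 \<le> u \<longrightarrow> u \<le> 1 \<longrightarrow> \<bar>w\<bar> \<le> u \<longrightarrow>
            jac_factor a b h z u w > 0 \<and> jac_factor b a h z u w < 0) \<longleftrightarrow>
         4 * h > 3 * a + b \<and>
         (\<exists>l1 l2. is_smaller_root (inner_quad a h b) l1 \<and>
                  is_middle_root (outer_cubic a h b) l2 \<and> z > max l1 l2)"
    (is "?signs \<longleftrightarrow> _ \<and> ?roots")
proof -
  have one: "inner_quad a h b 1 < 0 \<longleftrightarrow> 4 * h > 3 * a + b"
    by (auto simp: inner_quad_def)
  have "?signs \<longleftrightarrow> inner_quad a h b z < 0 \<and> outer_cubic a h b z > 0"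
    using type_A_condition[OF z bound] type_B_condition[OF z] by blast
  also have "\<dots> \<longleftrightarrow> inner_quad a h b 1 < 0 \<and> inner_quad a h b z < 0 \<and> outer_cubic a h b z > 0"
    using inner_quad_strict_antimono[OF z(2)] by force
  also have "\<dots> \<longleftrightarrow> inner_quad a h b 1 < 0 \<and> ?roots"
    using less_iff_smaller_root[OF _ z(2)] greater_iff_middle_root[OF z] by auto
  finally show ?thesis
    by (simp only: one)
qed

end

section \<open>The positivity criterion\<close>

text \<open>
  The mean value theorem on each half of \<open>[\<epsilon>, \<epsilon> + \<tau>]\<close> gives monotonicity; applied to \<open>s'\<close> between
  the two intermediate points, it gives convexity.
\<close>

lemma convex_radii_of_derivatives:
  fixes s s' s'' :: "real \<Rightarrow> real"
  assumes "\<epsilon> > 0" "\<tau> > 0" "\<epsilon> + \<tau> \<le> 1" "s \<epsilon> > 0"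
    and s': "\<And>t. t \<in> {0<..1} \<Longrightarrow> (s has_real_derivative s' t) (at t within {0<..1})"
    and s'': "\<And>t. t \<in> {0<..1} \<Longrightarrow> (s' has_real_derivative s'' t) (at t within {0<..1})"
    and pos: "\<And>t. t \<in> {0<..1} \<Longrightarrow> s' t > 0"
    and nonneg: "\<And>t. t \<in> {0<..1} \<Longrightarrow> s'' t \<ge> 0"
  shows "convex_radii (s \<epsilon>) (s (\<epsilon> + \<tau> / 2)) (s (\<epsilon> + \<tau>))"
proof -
  have mvt: "\<exists>c\<in>{x<..<y}. f y - f x = f' c * (y - x)"
    if "0 < x" "x < y" "y \<le> 1"
      and f: "\<And>t. t \<in> {0<..1} \<Longrightarrow> (f has_real_derivative f' t) (at t within {0<..1})"
    for x y :: real and f f' :: "real \<Rightarrow> real"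
  proof (rule mvt_simple[OF \<open>x < y\<close>])
    fix t assume "x \<le> t" "t \<le> y"
    then have "(f has_real_derivative f' t) (at t within {x..y})"
      using that by (intro DERIV_subset[OF f]) auto
    then show "(f has_derivative (*) (f' t)) (at t within {x..y})"
      by (simp add: has_field_derivative_def)
  qed
  obtain c where c: "\<epsilon> < c" "c < \<epsilon> + \<tau> / 2" "s (\<epsilon> + \<tau> / 2) - s \<epsilon> = s' c * (\<tau> / 2)"
    using mvt[OF _ _ _ s', of \<epsilon> "\<epsilon> + \<tau> / 2"] assms by auto
  obtain d where d: "\<epsilon> + \<tau> / 2 < d" "d < \<epsilon> + \<tau>"
      "s (\<epsilon> + \<tau>) - s (\<epsilon> + \<tau> / 2) = s' d * (\<tau> / 2)"
    using mvt[OF _ _ _ s', of "\<epsilon> + \<tau> / 2" "\<epsilon> + \<tau>"] assms by auto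
  obtain e where e: "c < e" "e < d" "s' d - s' c = s'' e * (d - c)"
    using mvt[OF _ _ _ s'', of c d] assms c d by auto
  have "s' c > 0" "s' d > 0" "s'' e \<ge> 0"
    using assms c d e by (auto intro!: pos nonneg)
  then have "s' c * (\<tau> / 2) > 0" "s' d * (\<tau> / 2) > 0" "s'' e * (d - c) \<ge> 0"
    using assms e by simp_all
  moreover from this have "s' c * (\<tau> / 2) \<le> s' d * (\<tau> / 2)"
    using e(3) assms by (intro mult_right_mono) auto
  ultimately show ?thesis
    using c(3) d(3) assms by unfold_locales linarith+
qed

theorem theorem3p4:
  fixes \<epsilon> \<tau> s\<^sub>0 s\<^sub>h s\<^sub>1 :: real and N :: nat and s s' s'' :: "real \<Rightarrow> real"
  assumes "\<epsilon> > 0" and "\<tau> > 0" and "\<epsilon> + \<tau> \<le> 1" and "N \<ge> 1"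
    and "\<And>t. t \<in> {0<..1} \<Longrightarrow> s t > 0"
    and "\<And>t. t \<in> {0<..1} \<Longrightarrow> (s has_real_derivative s' t) (at t within {0<..1})"
    and "\<And>t. t \<in> {0<..1} \<Longrightarrow> (s' has_real_derivative s'' t) (at t within {0<..1})"
    and "\<And>t. t \<in> {0<..1} \<Longrightarrow> s' t > 0"
    and "\<And>t. t \<in> {0<..1} \<Longrightarrow> s'' t \<ge> 0"
    and "s\<^sub>0 = s \<epsilon>" and "s\<^sub>h = s (\<epsilon> + \<tau> / 2)" and "s\<^sub>1 = s (\<epsilon> + \<tau>)"
    and "2 * s\<^sub>h > s\<^sub>1"
  shows "(\<forall>i<N. \<forall>x\<in>ref_triangle.
            det (jacobian (interp_comp (radial_field s) (type_A \<epsilon> \<tau> N i)) (at x)) > 0 \<and>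
            det (jacobian (interp_comp (radial_field s) (type_B \<epsilon> \<tau> N i)) (at x)) > 0) \<longleftrightarrow>
         (4 * s\<^sub>h > 3 * s\<^sub>0 + s\<^sub>1 \<and>
          (\<exists>l\<^sub>1 l\<^sub>2.
             is_smaller_root (\<lambda>z. 2 * s\<^sub>0 * z^2 - 4 * s\<^sub>h * z + s\<^sub>0 + s\<^sub>1) l\<^sub>1 \<and>
             is_middle_root (\<lambda>z. - 6 * s\<^sub>1 * z^3 + 4 * s\<^sub>h * z^2 + (s\<^sub>0 + 9 * s\<^sub>1) * z - 8 * s\<^sub>h) l\<^sub>2 \<and>
             cos (pi / (2 * real N)) > max l\<^sub>1 l\<^sub>2))"
proof -
  have "s \<epsilon> > 0"
    using assms by auto
  then interpret convex_radii s\<^sub>0 s\<^sub>h s\<^sub>1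
    unfolding assms(10-12)
    by (rule convex_radii_of_derivatives[OF assms(1-3) _ assms(6-9)])
  define z where "z = cos (pi / (2 * real N))"
  have angle: "0 < pi / (2 * real N)" "pi / (2 * real N) \<le> pi / 2"
    using \<open>N \<ge> 1\<close> by (auto simp: field_simps)
  have sin_pos: "sin (pi / (2 * real N)) > 0"
    using angle pi_gt_zero by (intro sin_gt_zero) linarith+
  have "0 \<le> z"
    unfolding z_def using angle by (intro cos_ge_zero) linarith+
  moreover have "z < 1"
    unfolding z_def using cos_monotone_0_pi[of 0 "pi / (2 * real N)"] angle pi_gt_zero by simp
  moreover have "(\<forall>i<N. \<forall>x\<in>ref_triangle.
            det (jacobian (interp_comp (radial_field s) (type_A \<epsilon> \<tau> N i)) (at x)) > 0 \<and>
            det (jacobian (interp_comp (radial_field s) (type_B \<epsilon> \<tau> N i)) (at x)) > 0) \<longleftrightarrow>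
      (\<forall>x\<in>ref_triangle. jac_factor s\<^sub>0 s\<^sub>1 s\<^sub>h z (x $ 1 + x $ 2) (x $ 2 - x $ 1) > 0 \<and>
                        jac_factor s\<^sub>1 s\<^sub>0 s\<^sub>h z (x $ 1 + x $ 2) (x $ 2 - x $ 1) < 0)"
    using exI[of "\<lambda>i. i < N" 0] \<open>N \<ge> 1\<close> sin_pos
    by (auto simp: det_jacobian_type_A[OF assms(1,2,4)] det_jacobian_type_B[OF assms(1,2,4)]
        zero_less_mult_iff mult_less_0_iff assms(10-12) z_def)
  moreover have "\<dots> \<longleftrightarrow>
      (\<forall>u w. 0 \<le> u \<longrightarrow> u \<le> 1 \<longrightarrow> \<bar>w\<bar> \<le> u \<longrightarrow>
            jac_factor s\<^sub>0 s\<^sub>1 s\<^sub>h z u w > 0 \<and> jac_factor s\<^sub>1 s\<^sub>0 s\<^sub>h z u w < 0)"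
    (is "(\<forall>x\<in>_. ?P (x $ 1 + x $ 2) (x $ 2 - x $ 1)) \<longleftrightarrow> _")
  proof (intro iffI allI impI ballI)
    fix u w :: real
    assume all: "\<forall>x\<in>ref_triangle. ?P (x $ 1 + x $ 2) (x $ 2 - x $ 1)"
      and "0 \<le> u" "u \<le> 1" "\<bar>w\<bar> \<le> u"
    \<comment> \<open>The point with coordinates \<open>u = x\<^sub>1 + x\<^sub>2\<close> and \<open>w = x\<^sub>2 - x\<^sub>1\<close>.\<close>
    then have "vector [(u - w) / 2, (u + w) / 2] \<in> ref_triangle"
      by (auto simp: ref_triangle_def field_simps)
    from all[rule_format, OF this] show "?P u w"
      by (simp add: field_simps)
  next
    fix x :: "real^2"
    assume "\<forall>u w. 0 \<le> u \<longrightarrow> u \<le> 1 \<longrightarrow> \<bar>w\<bar> \<le> u \<longrightarrow> ?P u w" "x \<in> ref_triangle"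
    then show "?P (x $ 1 + x $ 2) (x $ 2 - x $ 1)"
      by (auto simp: ref_triangle_def abs_le_iff)
  qed
  ultimately show ?thesis
    using jac_factor_signs_iff[of z] \<open>2 * s\<^sub>h > s\<^sub>1\<close>
    unfolding inner_quad_def outer_cubic_def z_def by simp
qed

end
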